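(* Let $J$ be a nonempty closed convex subset of a uniformly convex Banach space $G$ and let $S: J \to J$ be a nonexpansive mapping with $F(S) \neq \emptyset$. Let $\{\delta_n\}$ be a sequence in $(0,1)$ and let $\{c_n\}$ be the sequence generated from $c_1 \in J$ by $$a_n = Sc_n, \qquad b_n = (1-\delta_n)a_n + \delta_n S a_n, \qquad c_{n+1} = S b_n \qquad (n \in \mathbb{N}).$$ Then $\{c_n\}$ converges (in norm) to a point of $F(S)$ if and only if $\liminf_{n\to\infty} d(c_n, F(S)) = 0$.
   Context: A mapping $S: J \to J$ is nonexpansive if $\|Su - Sv\| \le \|u - v\|$ for all $u, v \in J$. $F(S) = \{x \in J : Sx = x\}$ denotes the set of fixed points of $S$, and $d(u, F(S)) = \inf\{\|u - q\| : q \in F(S)\}$. *)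

theory Defs
  imports "HOL-Analysis.Analysis"
begin

(* Clarkson's uniform convexity of the norm; the space is the whole type 'a. *)
definition uniformly_convex_space :: "'a::real_normed_vector itself \<Rightarrow> bool" where
  "uniformly_convex_space _ \<longleftrightarrow>
     (\<forall>\<epsilon>::real. 0 < \<epsilon> \<and> \<epsilon> \<le> 2 \<longrightarrow>
       (\<exists>\<delta>>0. \<forall>x y :: 'a. norm x \<le> 1 \<longrightarrow> norm y \<le> 1 \<longrightarrow> norm (x - y) \<ge> \<epsilon> \<longrightarrow>
          norm ((x + y) /\<^sub>R 2) \<le> 1 - \<delta>))"

(* A mapping S : J \<rightarrow> J is a total function on the type; only its values on J matter. *)
definition nonexpansive_on :: "'a::real_normed_vector set \<Rightarrow> ('a \<Rightarrow> 'a) \<Rightarrow> bool" where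
  "nonexpansive_on J S \<longleftrightarrow> (\<forall>u\<in>J. \<forall>v\<in>J. norm (S u - S v) \<le> norm (u - v))"

definition fixed_points :: "'a set \<Rightarrow> ('a \<Rightarrow> 'a) \<Rightarrow> 'a set" where
  "fixed_points J S = {x \<in> J. S x = x}"

end

theory Submission
  imports Defs
begin

text \<open>
  Every fixed point \<open>q\<close> of a nonexpansive map satisfies \<open>\<parallel>S u - q\<parallel> \<le> \<parallel>u - q\<parallel>\<close>, and norms are convex, so
  no stage of the iteration moves away from \<open>q\<close>: the sequence is Fejer monotone with respect to the
  fixed point set. For such a sequence, being once within \<open>e\<close> of some fixed point \<open>q\<close> means staying
  within \<open>e\<close> of that same \<open>q\<close> forever. If the lower limit of the distances is zero, this happens for
  every \<open>e > 0\<close>, so the sequence is Cauchy and its limit has distance zero from the fixed point set,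
  which is closed because \<open>S\<close> is continuous on the closed set \<open>J\<close> (\<open>closed_fixed_points\<close>). The converse
  is continuity of the distance function. The metric part of the argument is
  \<open>fejer_monotone_converges_iff\<close>; completeness of the space enters only there.
\<close>

lemma nonexpansive_on_imp_continuous_on:
  assumes "nonexpansive_on J S"
  shows "continuous_on J S"
proof -
  have "1-lipschitz_on J S"
    using assms by (auto intro!: lipschitz_onI simp: nonexpansive_on_def dist_norm)
  then show ?thesis
    by (rule lipschitz_on_continuous_on)
qed

lemma closed_fixed_points:
  assumes "closed J" "nonexpansive_on J S"
  shows "closed (fixed_points J S)"
proof -
  have "continuous_on J (\<lambda>x. S x - x)"
    by (intro continuous_intros nonexpansive_on_imp_continuous_on assms)
  then have "closed {x \<in> J. S x - x = 0}"
    using assms(1) by (rule continuous_closed_preimage_constant)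
  then show ?thesis
    by (simp add: fixed_points_def)
qed

lemma nonexpansive_on_fixed_point_le:
  assumes "nonexpansive_on J S" "q \<in> fixed_points J S" "u \<in> J"
  shows "norm (S u - q) \<le> norm (u - q)"
  using assms unfolding nonexpansive_on_def fixed_points_def by force

lemma norm_convex_combination_le:
  fixes x y q :: "'a::real_normed_vector"
  assumes "0 \<le> t" "t \<le> 1" "norm (x - q) \<le> r" "norm (y - q) \<le> r"
  shows "norm ((1 - t) *\<^sub>R x + t *\<^sub>R y - q) \<le> r"
proof -
  have "(1 - t) *\<^sub>R x + t *\<^sub>R y \<in> cball q r"
    using assms by (intro convexD[OF convex_cball]) (auto simp: dist_norm norm_minus_commute)
  then show ?thesis
    by (simp add: dist_norm norm_minus_commute)
qed

text \<open>
  Monotonicity is required only from an index \<open>N\<close> on, so that the lemma also applies to sequences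
  whose recursion starts later than at \<open>0\<close>.
\<close>

lemma fejer_monotone_converges_iff:
  fixes c :: "nat \<Rightarrow> 'a::complete_space"
  assumes "closed F" "F \<noteq> {}"
    and fejer: "\<And>n q. N \<le> n \<Longrightarrow> q \<in> F \<Longrightarrow> dist (c (Suc n)) q \<le> dist (c n) q"
  shows "(\<exists>p\<in>F. c \<longlonglongrightarrow> p) \<longleftrightarrow> liminf (\<lambda>n. ereal (infdist (c n) F)) = 0"
proof
  assume "\<exists>p\<in>F. c \<longlonglongrightarrow> p"
  then obtain p where "p \<in> F" "c \<longlonglongrightarrow> p"
    by blast
  then have "(\<lambda>n. infdist (c n) F) \<longlonglongrightarrow> 0"
    using tendsto_infdist[of c p sequentially F] by simp
  then have "(\<lambda>n. ereal (infdist (c n) F)) \<longlonglongrightarrow> 0"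
    by (simp add: zero_ereal_def)
  then show "liminf (\<lambda>n. ereal (infdist (c n) F)) = 0"
    by (intro lim_imp_Liminf) auto
next
  assume lim0: "liminf (\<lambda>n. ereal (infdist (c n) F)) = 0"
  have trapped: "\<exists>q\<in>F. \<exists>m. \<forall>n\<ge>m. dist (c n) q < e" if "e > 0" for e
  proof -
    have "\<exists>m\<ge>N. infdist (c m) F < e"
    proof (rule ccontr)
      assume "\<not> ?thesis"
      then have "\<forall>\<^sub>F n in sequentially. ereal e \<le> ereal (infdist (c n) F)"
        unfolding eventually_sequentially by (auto simp: not_less)
      then have "ereal e \<le> liminf (\<lambda>n. ereal (infdist (c n) F))"
        by (rule Liminf_bounded)
      with lim0 \<open>e > 0\<close> show False
        by simp
    qed
    then obtain m where m: "N \<le> m" "infdist (c m) F < e"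
      by blast
    then obtain q where q: "q \<in> F" "dist (c m) q < e"
      using \<open>F \<noteq> {}\<close> cINF_less_iff[of F "dist (c m)" e]
      by (auto simp: infdist_def)
    have "dist (c n) q < e" if "m \<le> n" for n
      using that
    proof (induction n rule: dec_induct)
      case base
      show ?case by (rule q)
    next
      case (step n)
      then show ?case
        using fejer[of n q] m q by simp
    qed
    with q show ?thesis
      by blast
  qed
  have "Cauchy c"
  proof (rule metric_CauchyI)
    fix e :: real
    assume "e > 0"
    then obtain q m where "\<forall>n\<ge>m. dist (c n) q < e / 2"
      using trapped[of "e / 2"] by auto
    then show "\<exists>M. \<forall>i\<ge>M. \<forall>j\<ge>M. dist (c i) (c j) < e"
      using dist_triangle_half_l by blast
  qed
  then obtain p where p: "c \<longlonglongrightarrow> p"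
    using Cauchy_convergent convergent_def by blast
  have "infdist p F \<le> e" if "e > 0" for e
  proof -
    obtain q m where q: "q \<in> F" and m: "\<forall>n\<ge>m. dist (c n) q < e"
      using trapped[OF \<open>e > 0\<close>] by blast
    have "(\<lambda>n. dist (c n) q) \<longlonglongrightarrow> dist p q"
      by (intro tendsto_intros p)
    then have "dist p q \<le> e"
      by (rule LIMSEQ_le_const2) (use m in \<open>auto intro: less_imp_le\<close>)
    with q show ?thesis
      by (meson infdist_le order_trans)
  qed
  then have "infdist p F = 0"
    by (metis antisym infdist_nonneg field_le_epsilon add_0)
  then have "p \<in> F"
    using assms in_closed_iff_infdist_zero by blast
  with p show "\<exists>p\<in>F. c \<longlonglongrightarrow> p"
    by blast
qed

theorem theorem3p3:
  fixes J :: "'a::banach set"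
    and S :: "'a \<Rightarrow> 'a"
    and \<delta> :: "nat \<Rightarrow> real"
    and a b c :: "nat \<Rightarrow> 'a"
  assumes "uniformly_convex_space TYPE('a)"
    and "J \<noteq> {}" and "closed J" and "convex J"
    and "S \<in> J \<rightarrow> J"
    and "nonexpansive_on J S"
    and "fixed_points J S \<noteq> {}"
    and "\<And>n. n \<ge> 1 \<Longrightarrow> 0 < \<delta> n \<and> \<delta> n < 1"
    and "c 1 \<in> J"
    and "\<And>n. n \<ge> 1 \<Longrightarrow> a n = S (c n)"
    and "\<And>n. n \<ge> 1 \<Longrightarrow> b n = (1 - \<delta> n) *\<^sub>R a n + \<delta> n *\<^sub>R S (a n)"
    and "\<And>n. n \<ge> 1 \<Longrightarrow> c (Suc n) = S (b n)"
  shows "(\<exists>p \<in> fixed_points J S. c \<longlonglongrightarrow> p) \<longleftrightarrow>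
         liminf (\<lambda>n. ereal (infdist (c n) (fixed_points J S))) = 0"
proof -
  let ?F = "fixed_points J S"
  have maps: "S x \<in> J" if "x \<in> J" for x
    using assms(5) that by auto
  have b_in: "b n \<in> J" if "n \<ge> 1" "c n \<in> J" for n
  proof -
    have "(1 - \<delta> n) *\<^sub>R a n + \<delta> n *\<^sub>R S (a n) \<in> J"
      using assms(8)[OF that(1)] assms(10)[OF that(1)] maps that(2)
      by (intro convexD[OF assms(4)]) auto
    then show ?thesis
      using assms(11)[OF that(1)] by simp
  qed
  have c_in: "c n \<in> J" if "n \<ge> 1" for n
    using that
  proof (induction n rule: dec_induct)
    case base
    show ?case by (rule assms(9))
  next
    case (step n)
    then show ?case
      using assms(12) b_in maps by simp
  qed
  have "dist (c (Suc n)) q \<le> dist (c n) q" if n: "1 \<le> n" and q: "q \<in> ?F" for n q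
  proof -
    note closer = nonexpansive_on_fixed_point_le[OF assms(6) q]
    have a_in: "a n \<in> J" and a_le: "norm (a n - q) \<le> norm (c n - q)"
      using closer c_in[OF n] maps assms(10)[OF n] by auto
    have "norm (S (a n) - q) \<le> norm (c n - q)"
      using closer[OF a_in] a_le by simp
    then have "norm (b n - q) \<le> norm (c n - q)"
      unfolding assms(11)[OF n] using a_le assms(8)[OF n]
      by (intro norm_convex_combination_le) auto
    then show ?thesis
      using closer[OF b_in[OF n c_in[OF n]]] assms(12)[OF n] by (simp add: dist_norm)
  qed
  then show ?thesis
    by (intro fejer_monotone_converges_iff[where N = 1] closed_fixed_points assms)
qed

end
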